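(* For every inverse semigroup $G$, the semigroup $\mathbf{Pr}(G)$ is an inverse semigroup.
   Context: For an inverse semigroup $G$, $s^*$ denotes the inverse of $s\in G$. $\mathbf{Pr}(G)$ denotes the universal semigroup defined by generators and relations as follows: there is one generator $[s]$ for each $s\in G$, and for all $s,t\in G$ the relations (i) $[s][t][t^*]=[st][t^*]$; (ii) $[s^*][s][t]=[s^*][st]$; (iii) $[s][s^*][s]=[s]$. *)

theory Defs
  imports Main
begin

locale semigroup_on =
  fixes S :: "'a set" and mul :: "'a \<Rightarrow> 'a \<Rightarrow> 'a"
  assumes mul_closed: "x \<in> S \<Longrightarrow> y \<in> S \<Longrightarrow> mul x y \<in> S"
    and mul_assoc: "x \<in> S \<Longrightarrow> y \<in> S \<Longrightarrow> z \<in> S \<Longrightarrow> mul (mul x y) z = mul x (mul y z)"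

definition is_inverse :: "('a \<Rightarrow> 'a \<Rightarrow> 'a) \<Rightarrow> 'a \<Rightarrow> 'a \<Rightarrow> bool" where
  "is_inverse mul s t \<longleftrightarrow> mul (mul s t) s = s \<and> mul (mul t s) t = t"

locale inverse_semigroup_on = semigroup_on +
  assumes ex1_inverse: "s \<in> S \<Longrightarrow> \<exists>!t. t \<in> S \<and> is_inverse mul s t"

text \<open>\<open>star S mul s\<close> is the element \<open>s\<^sup>*\<close>; it is meaningful only in an inverse semigroup.\<close>

definition star :: "'a set \<Rightarrow> ('a \<Rightarrow> 'a \<Rightarrow> 'a) \<Rightarrow> 'a \<Rightarrow> 'a" where
  "star S mul s = (THE t. t \<in> S \<and> is_inverse mul s t)"

lemma (in inverse_semigroup_on) star_closed: "s \<in> S \<Longrightarrow> star S mul s \<in> S"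
  and is_inverse_star: "s \<in> S \<Longrightarrow> is_inverse mul s (star S mul s)"
  unfolding star_def using theI'[OF ex1_inverse] by blast+

text \<open>
  Semigroups given by generators \<open>X\<close> and relations \<open>R\<close>. The free semigroup on \<open>X\<close> consists of
  the nonempty words over \<open>X\<close> under concatenation, a pair \<open>(u, v) \<in> R\<close> stands for the relation
  \<open>u = v\<close>, and the presented semigroup is the quotient by the least congruence containing \<open>R\<close>.
\<close>

definition words :: "'x set \<Rightarrow> 'x list set" where
  "words X = lists X - {[]}"

inductive_set pres_cong :: "'x set \<Rightarrow> ('x list \<times> 'x list) set \<Rightarrow> ('x list \<times> 'x list) set"
  for X :: "'x set" and R :: "('x list \<times> 'x list) set" where
  rel: "(u, v) \<in> R \<Longrightarrow> u \<in> words X \<Longrightarrow> v \<in> words X \<Longrightarrow> (u, v) \<in> pres_cong X R"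
| refl: "u \<in> words X \<Longrightarrow> (u, u) \<in> pres_cong X R"
| sym: "(u, v) \<in> pres_cong X R \<Longrightarrow> (v, u) \<in> pres_cong X R"
| trans: "(u, v) \<in> pres_cong X R \<Longrightarrow> (v, w) \<in> pres_cong X R \<Longrightarrow> (u, w) \<in> pres_cong X R"
| append: "(u, v) \<in> pres_cong X R \<Longrightarrow> (u', v') \<in> pres_cong X R
    \<Longrightarrow> (u @ u', v @ v') \<in> pres_cong X R"

definition pres_carrier :: "'x set \<Rightarrow> ('x list \<times> 'x list) set \<Rightarrow> 'x list set set" where
  "pres_carrier X R = words X // pres_cong X R"

definition pres_mul ::
    "'x set \<Rightarrow> ('x list \<times> 'x list) set \<Rightarrow> 'x list set \<Rightarrow> 'x list set \<Rightarrow> 'x list set" where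
  "pres_mul X R A B = pres_cong X R `` {u @ v | u v. u \<in> A \<and> v \<in> B}"

lemma pres_cong_words: "(u, v) \<in> pres_cong X R \<Longrightarrow> u \<in> words X \<and> v \<in> words X"
  by (induction rule: pres_cong.induct) (auto simp: words_def)

lemma equiv_pres_cong: "equiv (words X) (pres_cong X R)"
  by (rule equivI)
    (auto intro!: refl_onI symI transI intro: pres_cong.intros dest: pres_cong_words)

lemma pres_mul_class:
  assumes "u \<in> words X" "v \<in> words X"
  shows "pres_mul X R (pres_cong X R `` {u}) (pres_cong X R `` {v}) = pres_cong X R `` {u @ v}"
  unfolding pres_mul_def using assms
  by (auto intro: pres_cong.intros)

text \<open>Existence part of the universal property: if the evaluation \<open>ev\<close> of words in a semigroup \<open>T\<close>
  (determined by its values on letters) respects \<open>R\<close>, it factors through the presented semigroup.\<close>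

lemma pres_universal:
  fixes ev :: "'x list \<Rightarrow> 'b"
  assumes "semigroup_on T mul"
    and ev1: "\<And>x. x \<in> X \<Longrightarrow> ev [x] \<in> T"
    and ev2: "\<And>x w. x \<in> X \<Longrightarrow> w \<in> words X \<Longrightarrow> ev (x # w) = mul (ev [x]) (ev w)"
    and R: "\<And>u v. (u, v) \<in> R \<Longrightarrow> u \<in> words X \<Longrightarrow> v \<in> words X \<Longrightarrow> ev u = ev v"
  shows "\<exists>\<phi>. (\<forall>x\<in>X. \<phi> (pres_cong X R `` {[x]}) = ev [x])
    \<and> (\<forall>A\<in>pres_carrier X R. \<phi> A \<in> T)
    \<and> (\<forall>A\<in>pres_carrier X R. \<forall>B\<in>pres_carrier X R. \<phi> (pres_mul X R A B) = mul (\<phi> A) (\<phi> B))"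
proof -
  interpret semigroup_on T mul by fact
  have evT: "ev w \<in> T" if "w \<in> words X" for w
    using that
  proof (induction w)
    case (Cons x w)
    then show ?case using ev1 ev2[of x w] mul_closed
      by (cases w) (auto simp: words_def)
  qed (simp add: words_def)
  have app: "ev (u @ v) = mul (ev u) (ev v)" if "u \<in> words X" "v \<in> words X" for u v
    using that
  proof (induction u)
    case (Cons x u)
    show ?case
    proof (cases "u = []")
      case False
      then have "x \<in> X" "u \<in> words X" "u @ v \<in> words X"
        using Cons.prems by (auto simp: words_def)
      then show ?thesis using Cons ev2 mul_assoc evT ev1 by simp
    qed (use Cons ev2 in \<open>auto simp: words_def\<close>)
  qed (simp add: words_def)
  have resp: "ev u = ev v" if "(u, v) \<in> pres_cong X R" for u v
    using that
    by (induction rule: pres_cong.induct) (auto simp: R app dest!: pres_cong_words)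
  define \<phi> where "\<phi> A = ev (SOME w. w \<in> A)" for A
  have \<phi>: "\<phi> (pres_cong X R `` {w}) = ev w" if "w \<in> words X" for w
  proof -
    have "w \<in> pres_cong X R `` {w}" using that by (auto intro: pres_cong.refl)
    then have "(SOME y. y \<in> pres_cong X R `` {w}) \<in> pres_cong X R `` {w}" by (rule someI)
    then show ?thesis using resp by (auto simp: \<phi>_def)
  qed
  have "u @ v \<in> words X" if "u \<in> words X" "v \<in> words X" for u v
    using that by (auto simp: words_def)
  moreover have "[x] \<in> words X" if "x \<in> X" for x
    using that by (auto simp: words_def)
  ultimately show ?thesis
    by (intro exI[of _ \<phi>])
      (auto simp: pres_carrier_def \<phi> evT app pres_mul_class elim!: quotientE)
qed

text \<open>
  The generator \<open>[s]\<close> is the one-letter word \<open>[s]\<close>, so the product \<open>[s][t][u]\<close> of generators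
  is the word \<open>[s, t, u]\<close>.
\<close>

definition Pr_rels :: "'a set \<Rightarrow> ('a \<Rightarrow> 'a \<Rightarrow> 'a) \<Rightarrow> ('a list \<times> 'a list) set" where
  "Pr_rels G mul =
     {([s, t, star G mul t], [mul s t, star G mul t]) | s t. s \<in> G \<and> t \<in> G}
   \<union> {([star G mul s, s, t], [star G mul s, mul s t]) | s t. s \<in> G \<and> t \<in> G}
   \<union> {([s, star G mul s, s], [s]) | s. s \<in> G}"

text \<open>The side conditions of rule \<open>rel\<close> therefore exclude none of the relations.\<close>

lemma (in inverse_semigroup_on) Pr_rels_words: "Pr_rels S mul \<subseteq> words S \<times> words S"
  by (auto simp: Pr_rels_def words_def mul_closed star_closed)

definition Pr_carrier :: "'a set \<Rightarrow> ('a \<Rightarrow> 'a \<Rightarrow> 'a) \<Rightarrow> 'a list set set" where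
  "Pr_carrier G mul = pres_carrier G (Pr_rels G mul)"

definition Pr_mul ::
    "'a set \<Rightarrow> ('a \<Rightarrow> 'a \<Rightarrow> 'a) \<Rightarrow> 'a list set \<Rightarrow> 'a list set \<Rightarrow> 'a list set" where
  "Pr_mul G mul = pres_mul G (Pr_rels G mul)"

end

theory Submission
  imports Defs
begin

text \<open>
  Put \<open>\<epsilon> s = [s][s\<^sup>*]\<close>. The relations give \<open>[t] \<epsilon>(s) = \<epsilon>(ts) [t]\<close> and \<open>[t][s] = \<epsilon>(t) [ts]\<close>, and
  the \<open>\<epsilon> s\<close> are commuting idempotents. Hence every element has the form \<open>e [s]\<close> with \<open>e\<close> a
  product of such idempotents, and \<open>[s\<^sup>*] e\<close> shows that it is regular. Let \<open>\<phi>\<close>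
  be the homomorphism to \<open>G\<close> with \<open>\<phi> [s] = s\<close>. Then \<open>A = e [s]\<close> equals \<open>e [g]\<close> for \<open>g = \<phi> A\<close>. If
  \<open>A\<close> is idempotent then so is \<open>g\<close>, hence \<open>[g] = \<epsilon> g\<close>. So all idempotents are products of
  elements \<open>\<epsilon> r\<close>, and they commute.
\<close>

section \<open>Inverse semigroups\<close>

context semigroup_on
begin

text \<open>If \<open>s t s = s\<close>, then \<open>t s t\<close> is a two-sided inverse of
  \<open>s\<close>. Uniqueness comes from the commuting idempotents, which force any two inverses
  \<open>u\<close> and \<open>v\<close> of \<open>s\<close> to equal \<open>v s u\<close>.\<close>

lemma inverse_semigroup_on_if_regular:
  assumes regular: "\<And>s. s \<in> S \<Longrightarrow> \<exists>t\<in>S. mul (mul s t) s = s"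
    and commute: "\<And>e f. e \<in> S \<Longrightarrow> f \<in> S \<Longrightarrow> mul e e = e \<Longrightarrow> mul f f = f \<Longrightarrow> mul e f = mul f e"
  shows "inverse_semigroup_on S mul"
proof
  fix s assume s: "s \<in> S"
  obtain t where t: "t \<in> S" "mul (mul s t) s = s" using regular[OF s] by blast
  have "mul s (mul t (mul s y)) = mul s y" if "y \<in> S" for y
    using t s that by (metis mul_assoc mul_closed)
  moreover have "mul s (mul t s) = s" using t s by (simp add: mul_assoc)
  ultimately have inv: "is_inverse mul s (mul t (mul s t))"
    using s t(1) by (simp add: is_inverse_def mul_assoc mul_closed)
  show "\<exists>!t. t \<in> S \<and> is_inverse mul s t"
  proof
    show "mul t (mul s t) \<in> S \<and> is_inverse mul s (mul t (mul s t))"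
      using s t(1) inv by (simp add: mul_closed)
  next
    have eq: "u = mul v (mul s u) \<and> v = mul v (mul s u)"
      if uv: "u \<in> S" "is_inverse mul s u" "v \<in> S" "is_inverse mul s v" for u v
    proof
      have i: "mul s (mul u s) = s" "mul u (mul s u) = u" "mul s (mul v s) = s" "mul v (mul s v) = v"
        using uv s by (auto simp: is_inverse_def mul_assoc mul_closed)
      have idem: "mul (mul s u) (mul s u) = mul s u" "mul (mul s v) (mul s v) = mul s v"
        "mul (mul u s) (mul u s) = mul u s" "mul (mul v s) (mul v s) = mul v s"
        using i uv s by (simp_all add: mul_assoc mul_closed)
      \<comment> \<open>Write \<open>u = (u s)(v s) u\<close>; exchanging the idempotents
        \<open>u s\<close> and \<open>v s\<close> leaves \<open>v s u\<close>. For \<open>v\<close>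
        below, the idempotents \<open>s u\<close> and \<open>s v\<close> are exchanged
        instead.\<close>
      have "u = mul (mul u (mul s (mul v s))) u" using i uv s by (simp add: mul_assoc)
      also have "\<dots> = mul (mul (mul u s) (mul v s)) u" using uv s by (simp add: mul_assoc mul_closed)
      also have "\<dots> = mul (mul (mul v s) (mul u s)) u"
        using commute idem uv s by (simp add: mul_closed)
      also have "\<dots> = mul v (mul s u)" using i uv s by (simp add: mul_assoc mul_closed)
      finally show "u = mul v (mul s u)" .
      have "v = mul v (mul (mul s (mul u s)) v)" using i uv s by (simp add: mul_assoc)
      also have "\<dots> = mul v (mul (mul s u) (mul s v))" using uv s by (simp add: mul_assoc mul_closed)
      also have "\<dots> = mul v (mul (mul s v) (mul s u))"
        using commute idem uv s by (simp add: mul_closed)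
      also have "\<dots> = mul (mul v (mul s v)) (mul s u)" using uv s by (simp add: mul_assoc mul_closed)
      also have "\<dots> = mul v (mul s u)" using i by simp
      finally show "v = mul v (mul s u)" .
    qed
    show "u = mul t (mul s t)" if "u \<in> S \<and> is_inverse mul s u" for u
      using eq that inv s t mul_closed by metis
  qed
qed

end

section \<open>Inverses and idempotents in an inverse semigroup\<close>

context inverse_semigroup_on
begin

notation mul (infixl \<open>\<cdot>\<close> 70)

abbreviation inverse_of (\<open>(_\<^sup>\<star>)\<close> [1000] 1000) where
  "s\<^sup>\<star> \<equiv> star S mul s"

lemma star_unique: "s \<in> S \<Longrightarrow> t \<in> S \<Longrightarrow> is_inverse mul s t \<Longrightarrow> s\<^sup>\<star> = t"
  using ex1_inverse is_inverse_star star_closed by blast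

lemma mul_star_mul:
  assumes "s \<in> S"
  shows "s \<cdot> (s\<^sup>\<star> \<cdot> s) = s" "s\<^sup>\<star> \<cdot> (s \<cdot> s\<^sup>\<star>) = s\<^sup>\<star>"
  using is_inverse_star[OF assms] assms star_closed by (auto simp: is_inverse_def mul_assoc)

text \<open>The trailing factor lets the cancellation rules act inside right-associated
  products.\<close>

lemma mul_star_mul_left:
  assumes "s \<in> S" "t \<in> S"
  shows "s \<cdot> (s\<^sup>\<star> \<cdot> (s \<cdot> t)) = s \<cdot> t" "s\<^sup>\<star> \<cdot> (s \<cdot> (s\<^sup>\<star> \<cdot> t)) = s\<^sup>\<star> \<cdot> t"
  using mul_star_mul[OF assms(1)] assms star_closed by (metis mul_assoc mul_closed)+

lemma star_star: "s \<in> S \<Longrightarrow> s\<^sup>\<star>\<^sup>\<star> = s"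
  using is_inverse_star star_unique star_closed by (simp add: is_inverse_def)

lemma star_idem: "e \<in> S \<Longrightarrow> e \<cdot> e = e \<Longrightarrow> e\<^sup>\<star> = e"
  by (simp add: star_unique is_inverse_def)

text \<open>Besides \<open>x = (e f)\<^sup>\<star>\<close>, the element \<open>f x e\<close> is an
  inverse of \<open>e f\<close>. So \<open>x = f x e\<close> by uniqueness, which makes
  \<open>x\<close> idempotent. An idempotent is its own inverse, hence
  \<open>e f = x\<^sup>\<star> = x\<close>.\<close>

lemma mul_idem:
  assumes S: "e \<in> S" "f \<in> S" and idem: "e \<cdot> e = e" "f \<cdot> f = f"
  shows "(e \<cdot> f) \<cdot> (e \<cdot> f) = e \<cdot> f"
proof -
  define x where "x = (e \<cdot> f)\<^sup>\<star>"
  have x: "x \<in> S" using S by (simp add: x_def star_closed mul_closed)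
  have left: "e \<cdot> (e \<cdot> y) = e \<cdot> y" "f \<cdot> (f \<cdot> y) = f \<cdot> y" if "y \<in> S" for y
    using S idem that by (metis mul_assoc)+
  have x1: "e \<cdot> (f \<cdot> (x \<cdot> (e \<cdot> f))) = e \<cdot> f" and x2: "x \<cdot> (e \<cdot> (f \<cdot> x)) = x"
    using mul_star_mul[of "e \<cdot> f"] S x by (simp_all add: x_def[symmetric] mul_assoc mul_closed)
  have x2': "x \<cdot> (e \<cdot> (f \<cdot> (x \<cdot> e))) = x \<cdot> e"
    using S x arg_cong[OF x2, of "\<lambda>z. z \<cdot> e"] by (simp add: mul_assoc mul_closed)
  have "is_inverse mul (e \<cdot> f) (f \<cdot> (x \<cdot> e))"
    using S x idem left x1 x2' by (simp add: is_inverse_def mul_assoc mul_closed)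
  then have xe: "x = f \<cdot> (x \<cdot> e)"
    using S x star_unique by (simp add: x_def mul_closed)
  have "x \<cdot> x = (f \<cdot> (x \<cdot> e)) \<cdot> (f \<cdot> (x \<cdot> e))" using xe by simp
  also have "\<dots> = f \<cdot> (x \<cdot> e)" using x2' S x by (simp add: mul_assoc mul_closed)
  finally have "x \<cdot> x = x" using xe by simp
  moreover have "x\<^sup>\<star> = e \<cdot> f" using S by (simp add: x_def star_star mul_closed)
  ultimately show ?thesis using star_idem[OF x] by simp
qed

text \<open>Since \<open>e f\<close> and \<open>f e\<close> are idempotent, \<open>f e\<close> is an
  inverse of \<open>e f\<close>. But \<open>e f\<close> is its own inverse, so uniqueness
  applies.\<close>

lemma idem_commute:
  assumes S: "e \<in> S" "f \<in> S" and idem: "e \<cdot> e = e" "f \<cdot> f = f"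
  shows "e \<cdot> f = f \<cdot> e"
proof -
  have left: "e \<cdot> (e \<cdot> y) = e \<cdot> y" "f \<cdot> (f \<cdot> y) = f \<cdot> y" if "y \<in> S" for y
    using S idem that by (metis mul_assoc)+
  have "e \<cdot> (f \<cdot> (e \<cdot> f)) = e \<cdot> f" "f \<cdot> (e \<cdot> (f \<cdot> e)) = f \<cdot> e"
    using mul_idem[of e f] mul_idem[of f e] assms by (simp_all add: mul_assoc mul_closed)
  then have "is_inverse mul (e \<cdot> f) (f \<cdot> e)"
    using S left by (simp add: is_inverse_def mul_assoc mul_closed)
  moreover have "(e \<cdot> f)\<^sup>\<star> = e \<cdot> f" using star_idem mul_idem assms mul_closed by simp
  ultimately show ?thesis using star_unique[of "e \<cdot> f" "f \<cdot> e"] S mul_closed by simp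
qed

lemma mul_star_idem:
  assumes "s \<in> S"
  shows "(s \<cdot> s\<^sup>\<star>) \<cdot> (s \<cdot> s\<^sup>\<star>) = s \<cdot> s\<^sup>\<star>" "(s\<^sup>\<star> \<cdot> s) \<cdot> (s\<^sup>\<star> \<cdot> s) = s\<^sup>\<star> \<cdot> s"
  using assms by (simp_all add: mul_assoc mul_closed star_closed mul_star_mul)

lemma mul_star_commute:
  assumes "s \<in> S" "t \<in> S"
  shows "t\<^sup>\<star> \<cdot> t \<cdot> (s \<cdot> s\<^sup>\<star>) = s \<cdot> s\<^sup>\<star> \<cdot> (t\<^sup>\<star> \<cdot> t)"
  using assms by (simp add: idem_commute mul_star_idem mul_closed star_closed)

text \<open>The idempotents \<open>t t\<^sup>\<star>\<close> and \<open>s\<^sup>\<star> s\<close>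
  commute, which brings each factor next to its own inverse.\<close>

lemma star_mul:
  assumes S: "s \<in> S" "t \<in> S"
  shows "(s \<cdot> t)\<^sup>\<star> = t\<^sup>\<star> \<cdot> s\<^sup>\<star>"
proof -
  note [simp] = star_closed mul_closed
  have "s \<cdot> t \<cdot> (t\<^sup>\<star> \<cdot> s\<^sup>\<star>) \<cdot> (s \<cdot> t) = s \<cdot> ((t \<cdot> t\<^sup>\<star>) \<cdot> (s\<^sup>\<star> \<cdot> s)) \<cdot> t"
    using S by (simp add: mul_assoc)
  also have "\<dots> = s \<cdot> ((s\<^sup>\<star> \<cdot> s) \<cdot> (t \<cdot> t\<^sup>\<star>)) \<cdot> t" using mul_star_commute[OF S(2,1)] by simp
  also have "\<dots> = s \<cdot> t" using S by (simp add: mul_assoc mul_star_mul mul_star_mul_left)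
  finally have 1: "s \<cdot> t \<cdot> (t\<^sup>\<star> \<cdot> s\<^sup>\<star>) \<cdot> (s \<cdot> t) = s \<cdot> t" .
  have "t\<^sup>\<star> \<cdot> s\<^sup>\<star> \<cdot> (s \<cdot> t) \<cdot> (t\<^sup>\<star> \<cdot> s\<^sup>\<star>) = t\<^sup>\<star> \<cdot> ((s\<^sup>\<star> \<cdot> s) \<cdot> (t \<cdot> t\<^sup>\<star>)) \<cdot> s\<^sup>\<star>"
    using S by (simp add: mul_assoc)
  also have "\<dots> = t\<^sup>\<star> \<cdot> ((t \<cdot> t\<^sup>\<star>) \<cdot> (s\<^sup>\<star> \<cdot> s)) \<cdot> s\<^sup>\<star>" using mul_star_commute[OF S(2,1)] by simp
  also have "\<dots> = t\<^sup>\<star> \<cdot> s\<^sup>\<star>" using S by (simp add: mul_assoc mul_star_mul mul_star_mul_left)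
  finally show ?thesis using 1 S by (intro star_unique) (simp_all add: is_inverse_def)
qed

end

section \<open>Presented semigroups\<close>

lemma words_append: "u \<in> words X \<Longrightarrow> v \<in> words X \<Longrightarrow> u @ v \<in> words X"
  by (auto simp: words_def)

lemma words_singleton: "x \<in> X \<Longrightarrow> [x] \<in> words X"
  by (simp add: words_def)

lemma pres_class_in_carrier: "u \<in> words X \<Longrightarrow> pres_cong X R `` {u} \<in> pres_carrier X R"
  by (simp add: pres_carrier_def quotientI)

lemma semigroup_on_pres: "semigroup_on (pres_carrier X R) (pres_mul X R)"
  by unfold_locales
    (auto simp: pres_carrier_def pres_mul_class words_append quotientI elim!: quotientE)

lemma pres_carrier_induct:
  assumes A: "A \<in> pres_carrier X R"
    and gen: "\<And>x. x \<in> X \<Longrightarrow> Q (pres_cong X R `` {[x]})"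
    and mul: "\<And>x B. x \<in> X \<Longrightarrow> B \<in> pres_carrier X R \<Longrightarrow> Q B
      \<Longrightarrow> Q (pres_mul X R (pres_cong X R `` {[x]}) B)"
  shows "Q A"
proof -
  have "Q (pres_cong X R `` {w})" if "w \<in> words X" for w
    using that
  proof (induction w)
    case (Cons x w)
    show ?case
    proof (cases "w = []")
      case False
      then have "x \<in> X" "w \<in> words X" using Cons.prems by (auto simp: words_def)
      then show ?thesis
        using mul[of x "pres_cong X R `` {w}"] Cons.IH
        by (simp add: pres_mul_class words_singleton pres_class_in_carrier)
    qed (use Cons.prems gen in \<open>auto simp: words_def\<close>)
  qed (simp add: words_def)
  then show ?thesis using A by (auto simp: pres_carrier_def elim!: quotientE)
qed

lemma pres_class_eq:
  "(u, v) \<in> R \<Longrightarrow> u \<in> words X \<Longrightarrow> v \<in> words X \<Longrightarrow> pres_cong X R `` {u} = pres_cong X R `` {v}"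
  by (rule equiv_class_eq[OF equiv_pres_cong]) (rule pres_cong.rel)

section \<open>The semigroup \<open>Pr(G)\<close>\<close>

text \<open>This evaluation induces the homomorphism from \<open>Pr\<close> back to
  \<open>S\<close>. There need not be a unit, so the recursion stops at single letters; the empty
  word lies outside \<open>words\<close>.\<close>

fun word_prod :: "('a \<Rightarrow> 'a \<Rightarrow> 'a) \<Rightarrow> 'a list \<Rightarrow> 'a" where
  "word_prod m [] = undefined"
| "word_prod m [x] = x"
| "word_prod m (x # y # w) = m x (word_prod m (y # w))"

context inverse_semigroup_on
begin

abbreviation Pr where
  "Pr \<equiv> Pr_carrier S mul"

abbreviation Pr_mult (infixl \<open>\<bullet>\<close> 70) where
  "A \<bullet> B \<equiv> Pr_mul S mul A B"

definition gen :: "'a \<Rightarrow> 'a list set" where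
  "gen s = pres_cong S (Pr_rels S mul) `` {[s]}"

definition eps :: "'a \<Rightarrow> 'a list set" where
  "eps s = gen s \<bullet> gen (s\<^sup>\<star>)"

sublocale Pr: semigroup_on Pr "(\<bullet>)"
  unfolding Pr_carrier_def Pr_mul_def by (rule semigroup_on_pres)

lemma gen_closed: "s \<in> S \<Longrightarrow> gen s \<in> Pr"
  by (simp add: gen_def Pr_carrier_def pres_class_in_carrier words_singleton)

lemma eps_closed: "s \<in> S \<Longrightarrow> eps s \<in> Pr"
  by (simp add: eps_def gen_closed star_closed Pr.mul_closed)

lemma Pr_induct [consumes 1, case_names gen mul]:
  assumes "A \<in> Pr" "\<And>s. s \<in> S \<Longrightarrow> Q (gen s)"
    "\<And>s B. s \<in> S \<Longrightarrow> B \<in> Pr \<Longrightarrow> Q B \<Longrightarrow> Q (gen s \<bullet> B)"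
  shows "Q A"
  using assms unfolding gen_def Pr_carrier_def Pr_mul_def by (rule pres_carrier_induct)

lemma gen_relations:
  assumes "s \<in> S" "t \<in> S"
  shows "gen s \<bullet> (gen t \<bullet> gen (t\<^sup>\<star>)) = gen (s \<cdot> t) \<bullet> gen (t\<^sup>\<star>)"
    and "gen (s\<^sup>\<star>) \<bullet> (gen s \<bullet> gen t) = gen (s\<^sup>\<star>) \<bullet> gen (s \<cdot> t)"
    and "gen s \<bullet> (gen (s\<^sup>\<star>) \<bullet> gen s) = gen s"
proof -
  have two: "gen a \<bullet> gen b = pres_cong S (Pr_rels S mul) `` {[a, b]}" if "a \<in> S" "b \<in> S" for a b
    using pres_mul_class[of "[a]" S "[b]"] that by (simp add: gen_def Pr_mul_def words_singleton)
  have three: "gen a \<bullet> (gen b \<bullet> gen c) = pres_cong S (Pr_rels S mul) `` {[a, b, c]}"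
    if "a \<in> S" "b \<in> S" "c \<in> S" for a b c
    using pres_mul_class[of "[a]" S "[b, c]"] two that
    by (simp add: gen_def Pr_mul_def words_def)
  have rel: "pres_cong S (Pr_rels S mul) `` {u} = pres_cong S (Pr_rels S mul) `` {v}"
    if "(u, v) \<in> Pr_rels S mul" for u v
    using pres_class_eq[OF that] that Pr_rels_words by blast
  have "([s, t, t\<^sup>\<star>], [s \<cdot> t, t\<^sup>\<star>]) \<in> Pr_rels S mul"
    "([s\<^sup>\<star>, s, t], [s\<^sup>\<star>, s \<cdot> t]) \<in> Pr_rels S mul"
    using assms by (auto simp: Pr_rels_def)
  from this[THEN rel] show "gen s \<bullet> (gen t \<bullet> gen (t\<^sup>\<star>)) = gen (s \<cdot> t) \<bullet> gen (t\<^sup>\<star>)"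
    and "gen (s\<^sup>\<star>) \<bullet> (gen s \<bullet> gen t) = gen (s\<^sup>\<star>) \<bullet> gen (s \<cdot> t)"
    using assms by (simp_all add: three two[of "s \<cdot> t"] two[of _ "s \<cdot> t"] star_closed mul_closed)
  show "gen s \<bullet> (gen (s\<^sup>\<star>) \<bullet> gen s) = gen s"
    using assms by (simp add: three star_closed gen_def[of s, symmetric])
      (unfold gen_def, rule rel, auto simp: Pr_rels_def)
qed

lemma word_prod_relations:
  assumes "(u, v) \<in> Pr_rels S mul"
  shows "word_prod mul u = word_prod mul v"
  using assms
  by (auto simp: Pr_rels_def mul_assoc mul_closed star_closed mul_star_mul)

text \<open>\<open>word_prod\<close> respects the defining relations, so the universal property
  applies. The map later identifies a suitable last letter in the normal form of an
  idempotent.\<close>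

lemma Pr_retraction:
  obtains \<phi> where "\<And>s. s \<in> S \<Longrightarrow> \<phi> (gen s) = s" "\<And>A. A \<in> Pr \<Longrightarrow> \<phi> A \<in> S"
    "\<And>A B. A \<in> Pr \<Longrightarrow> B \<in> Pr \<Longrightarrow> \<phi> (A \<bullet> B) = \<phi> A \<cdot> \<phi> B"
proof -
  have "word_prod mul (x # w) = word_prod mul [x] \<cdot> word_prod mul w" if "w \<in> words S" for x w
    using that by (cases w) (auto simp: words_def)
  then have "\<exists>\<phi>. (\<forall>x\<in>S. \<phi> (gen x) = word_prod mul [x]) \<and> (\<forall>A\<in>Pr. \<phi> A \<in> S)
    \<and> (\<forall>A\<in>Pr. \<forall>B\<in>Pr. \<phi> (A \<bullet> B) = \<phi> A \<cdot> \<phi> B)"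
    unfolding gen_def Pr_carrier_def Pr_mul_def
    by (intro pres_universal word_prod_relations semigroup_on_axioms) auto
  then obtain \<phi> where "\<forall>x\<in>S. \<phi> (gen x) = word_prod mul [x]" "\<forall>A\<in>Pr. \<phi> A \<in> S"
    "\<forall>A\<in>Pr. \<forall>B\<in>Pr. \<phi> (A \<bullet> B) = \<phi> A \<cdot> \<phi> B"
    by blast
  then show ?thesis using that[of \<phi>] by simp
qed

section \<open>Products of generators and commutation of the elements \<open>eps s\<close>\<close>

lemmas closed = mul_closed star_closed Pr.mul_closed gen_closed eps_closed

lemma gen_relations_left:
  assumes "s \<in> S" "t \<in> S" "A \<in> Pr"
  shows "gen s \<bullet> (gen t \<bullet> (gen (t\<^sup>\<star>) \<bullet> A)) = gen (s \<cdot> t) \<bullet> (gen (t\<^sup>\<star>) \<bullet> A)"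
    and "gen (s\<^sup>\<star>) \<bullet> (gen s \<bullet> (gen t \<bullet> A)) = gen (s\<^sup>\<star>) \<bullet> (gen (s \<cdot> t) \<bullet> A)"
    and "gen s \<bullet> (gen (s\<^sup>\<star>) \<bullet> (gen s \<bullet> A)) = gen s \<bullet> A"
  using arg_cong[OF gen_relations(1)[OF assms(1,2)], of "\<lambda>B. B \<bullet> A"]
    arg_cong[OF gen_relations(2)[OF assms(1,2)], of "\<lambda>B. B \<bullet> A"]
    arg_cong[OF gen_relations(3)[OF assms(1,2)], of "\<lambda>B. B \<bullet> A"] assms
  by (simp_all add: Pr.mul_assoc closed)

text \<open>Relation (iii) expands \<open>gen s\<close>, relation (ii) for \<open>s\<close> merges
  the last two letters into \<open>s t\<close>, and relation (ii) for \<open>s\<^sup>\<star>\<close>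
  then merges \<open>s\<^sup>\<star>\<close> with \<open>s t\<close>.\<close>

lemma gen_mul_range:
  assumes "s \<in> S" "t \<in> S"
  shows "gen s \<bullet> gen (s\<^sup>\<star> \<cdot> (s \<cdot> t)) = gen s \<bullet> gen t"
proof -
  have "gen s \<bullet> gen t = gen s \<bullet> (gen (s\<^sup>\<star>) \<bullet> (gen s \<bullet> gen t))"
    using assms by (simp add: gen_relations_left(3) closed)
  also have "\<dots> = gen s \<bullet> (gen (s\<^sup>\<star>) \<bullet> gen (s \<cdot> t))"
    using assms by (simp add: gen_relations closed)
  also have "\<dots> = gen s \<bullet> gen (s\<^sup>\<star> \<cdot> (s \<cdot> t))"
    using gen_relations(2)[of "s\<^sup>\<star>" "s \<cdot> t"] assms by (simp add: closed star_star)
  finally show ?thesis by simp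
qed

text \<open>The mirror image of \<open>gen_mul_range\<close>, with relation (i) in place of
  (ii).\<close>

lemma gen_mul_source:
  assumes "s \<in> S" "t \<in> S"
  shows "gen (s \<cdot> (t \<cdot> t\<^sup>\<star>)) \<bullet> gen t = gen s \<bullet> gen t"
proof -
  have "gen s \<bullet> gen t = gen s \<bullet> (gen t \<bullet> (gen (t\<^sup>\<star>) \<bullet> gen t))"
    using assms by (simp add: gen_relations)
  also have "\<dots> = gen (s \<cdot> t) \<bullet> (gen (t\<^sup>\<star>) \<bullet> gen t)"
    using assms by (simp add: gen_relations_left closed)
  also have "\<dots> = gen (s \<cdot> (t \<cdot> t\<^sup>\<star>)) \<bullet> gen t"
    using gen_relations(1)[of "s \<cdot> t" "t\<^sup>\<star>"] assms by (simp add: closed star_star mul_assoc)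
  finally show ?thesis by simp
qed

text \<open>Expand \<open>gen s\<close> by (iii) and apply (ii). Thus \<open>gen\<close> is
  multiplicative up to the factor \<open>eps s\<close>.\<close>

lemma gen_mul_gen:
  assumes "s \<in> S" "t \<in> S"
  shows "gen s \<bullet> gen t = eps s \<bullet> gen (s \<cdot> t)"
  using gen_relations(2)[OF assms] gen_relations_left(3)[of s s "gen t"] assms
  by (simp add: eps_def Pr.mul_assoc closed)

lemma eps_mul_gen: "s \<in> S \<Longrightarrow> eps s \<bullet> gen s = gen s"
  by (simp add: eps_def Pr.mul_assoc closed gen_relations)

text \<open>As \<open>e\<^sup>\<star> = e\<close>, the cube of \<open>gen e\<close> is its square by
  (i) and \<open>gen e\<close> itself by (iii).\<close>

lemma gen_idem:
  assumes "e \<in> S" "e \<cdot> e = e"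
  shows "gen e \<bullet> gen e = gen e"
  using gen_relations(1,3)[of e e] assms by (simp add: star_idem)

text \<open>The range and source lemmas change both letters to \<open>e f\<close>, and
  \<open>gen_idem\<close> applies. In particular, \<open>gen\<close> sends idempotents to commuting
  elements.\<close>

lemma gen_mul_idem:
  assumes "e \<in> S" "f \<in> S" "e \<cdot> e = e" "f \<cdot> f = f"
  shows "gen e \<bullet> gen f = gen (e \<cdot> f)"
proof -
  have idem: "(e \<cdot> f) \<cdot> (e \<cdot> f) = e \<cdot> f" using mul_idem assms by simp
  have "gen e \<bullet> gen f = gen (e \<cdot> f) \<bullet> gen f"
    using gen_mul_source[of e f] assms by (simp add: star_idem)
  also have "\<dots> = gen (e \<cdot> f) \<bullet> gen ((e \<cdot> f) \<cdot> ((e \<cdot> f) \<cdot> f))"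
    using gen_mul_range[of "e \<cdot> f" f] assms star_idem[OF _ idem] by (simp add: closed)
  also have "(e \<cdot> f) \<cdot> ((e \<cdot> f) \<cdot> f) = e \<cdot> f"
    using assms idem by (simp add: mul_assoc closed)
  also have "gen (e \<cdot> f) \<bullet> gen (e \<cdot> f) = gen (e \<cdot> f)" using gen_idem[OF _ idem] assms closed by simp
  finally show ?thesis .
qed

text \<open>With \<open>a = t s\<close>, relation (i) and \<open>gen_mul_gen\<close> give
  \<open>eps a\<close> followed by the letter \<open>a s\<^sup>\<star>\<close>. Commuting
  idempotents in \<open>S\<close> show that this letter is \<open>a a\<^sup>\<star> t\<close>, and
  \<open>gen_mul_range\<close> lets \<open>eps a\<close> reduce it to \<open>t\<close>.\<close>

lemma gen_mul_eps:
  assumes "s \<in> S" "t \<in> S"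
  shows "gen t \<bullet> eps s = eps (t \<cdot> s) \<bullet> gen t"
proof -
  define a where "a = t \<cdot> s"
  have a: "a \<in> S" using assms by (simp add: a_def closed)
  have "a \<cdot> (a\<^sup>\<star> \<cdot> t) = t \<cdot> ((s \<cdot> s\<^sup>\<star>) \<cdot> (t\<^sup>\<star> \<cdot> t))"
    using assms by (simp add: a_def star_mul mul_assoc closed)
  also have "\<dots> = t \<cdot> ((t\<^sup>\<star> \<cdot> t) \<cdot> (s \<cdot> s\<^sup>\<star>))" using mul_star_commute[OF assms] by simp
  also have "\<dots> = a \<cdot> s\<^sup>\<star>" using assms by (simp add: a_def mul_assoc closed mul_star_mul_left)
  finally have aat: "a \<cdot> (a\<^sup>\<star> \<cdot> t) = a \<cdot> s\<^sup>\<star>" .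
  have "gen t \<bullet> eps s = gen a \<bullet> gen (s\<^sup>\<star>)"
    using assms by (simp add: eps_def a_def gen_relations)
  also have "\<dots> = eps a \<bullet> gen (a \<cdot> s\<^sup>\<star>)" using assms a by (simp add: gen_mul_gen closed)
  also have "\<dots> = gen a \<bullet> (gen (a\<^sup>\<star>) \<bullet> gen (a \<cdot> (a\<^sup>\<star> \<cdot> t)))"
    using assms a by (simp add: eps_def aat Pr.mul_assoc closed)
  also have "\<dots> = eps a \<bullet> gen t"
    using gen_mul_range[of "a\<^sup>\<star>" t] assms a by (simp add: star_star eps_def Pr.mul_assoc closed)
  finally show ?thesis by (simp add: a_def)
qed

text \<open>Commutation up to the factor \<open>gen (s \<cdot> s\<^sup>\<star>)\<close>, which
  \<open>eps_commute\<close> removes. Moving \<open>eps t\<close> to the left past both letters of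
  \<open>eps s\<close> turns it into \<open>eps (s s\<^sup>\<star> t)\<close>.\<close>

lemma eps_mul_eps_aux:
  assumes "s \<in> S" "t \<in> S"
  shows "eps s \<bullet> eps t = gen (s \<cdot> s\<^sup>\<star>) \<bullet> (eps t \<bullet> eps s)"
proof -
  have "eps s \<bullet> eps t = gen s \<bullet> (gen (s\<^sup>\<star>) \<bullet> eps t)"
    using assms by (simp add: eps_def[of s] Pr.mul_assoc closed)
  also have "\<dots> = gen s \<bullet> (eps (s\<^sup>\<star> \<cdot> t) \<bullet> gen (s\<^sup>\<star>))" using assms by (simp add: gen_mul_eps closed)
  also have "\<dots> = gen s \<bullet> eps (s\<^sup>\<star> \<cdot> t) \<bullet> gen (s\<^sup>\<star>)" using assms by (simp add: Pr.mul_assoc closed)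
  also have "\<dots> = eps (s \<cdot> (s\<^sup>\<star> \<cdot> t)) \<bullet> eps s"
    using assms by (simp add: gen_mul_eps closed eps_def[of s] Pr.mul_assoc)
  also have "\<dots> = gen (s \<cdot> (s\<^sup>\<star> \<cdot> t)) \<bullet> (gen (t\<^sup>\<star> \<cdot> (s \<cdot> s\<^sup>\<star>)) \<bullet> gen s) \<bullet> gen (s\<^sup>\<star>)"
    using assms by (simp add: eps_def star_mul star_star mul_assoc Pr.mul_assoc closed)
  \<comment> \<open>The following \<open>gen s\<close> absorbs \<open>s s\<^sup>\<star>\<close> from
    the second letter; relation (i), read backwards, then splits it off the first letter.\<close>
  also have "\<dots> = gen (s \<cdot> s\<^sup>\<star> \<cdot> t) \<bullet> (gen (t\<^sup>\<star>) \<bullet> (gen s \<bullet> gen (s\<^sup>\<star>)))"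
    using assms by (simp add: gen_mul_source closed mul_assoc Pr.mul_assoc)
  also have "\<dots> = gen (s \<cdot> s\<^sup>\<star>) \<bullet> (gen t \<bullet> (gen (t\<^sup>\<star>) \<bullet> (gen s \<bullet> gen (s\<^sup>\<star>))))"
    using assms by (subst gen_relations_left(1)) (simp_all add: closed)
  also have "\<dots> = gen (s \<cdot> s\<^sup>\<star>) \<bullet> (eps t \<bullet> eps s)"
    using assms by (simp add: eps_def Pr.mul_assoc closed)
  finally show ?thesis .
qed

lemma gen_mul_eps_absorb:
  assumes "s \<in> S"
  shows "gen (s \<cdot> s\<^sup>\<star>) \<bullet> eps s = eps s"
  using gen_relations(1)[of "s \<cdot> s\<^sup>\<star>" s] assms
  by (simp add: eps_def closed mul_assoc mul_star_mul)

text \<open>Applying the auxiliary identity twice puts \<open>gen p\<close> and \<open>gen q\<close>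
  in front of \<open>eps s \<bullet> eps t\<close>. These two commute, and \<open>eps s\<close>
  absorbs \<open>gen p\<close>; the remaining \<open>gen q\<close> gives
  \<open>eps t \<bullet> eps s\<close>.\<close>

lemma eps_commute:
  assumes "s \<in> S" "t \<in> S"
  shows "eps s \<bullet> eps t = eps t \<bullet> eps s"
proof -
  define p q where "p = s \<cdot> s\<^sup>\<star>" and "q = t \<cdot> t\<^sup>\<star>"
  have S: "p \<in> S" "q \<in> S" using assms by (simp_all add: p_def q_def closed)
  have idem: "p \<cdot> p = p" "q \<cdot> q = q" using assms by (simp_all add: p_def q_def mul_star_idem)
  have st: "eps s \<bullet> eps t = gen p \<bullet> (eps t \<bullet> eps s)" and ts: "eps t \<bullet> eps s = gen q \<bullet> (eps s \<bullet> eps t)"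
    unfolding p_def q_def by (rule eps_mul_eps_aux; fact)+
  have pst: "gen p \<bullet> (eps s \<bullet> eps t) = eps s \<bullet> eps t"
    using gen_mul_eps_absorb[of s] assms S by (simp add: p_def[symmetric] Pr.mul_assoc[symmetric] closed)
  have "eps s \<bullet> eps t = gen p \<bullet> (gen q \<bullet> (eps s \<bullet> eps t))"
    unfolding ts[symmetric] by (rule st)
  also have "\<dots> = gen p \<bullet> gen q \<bullet> (eps s \<bullet> eps t)" using assms S by (simp add: Pr.mul_assoc closed)
  also have "gen p \<bullet> gen q = gen q \<bullet> gen p"
    using S idem idem_commute[of p q] by (simp add: gen_mul_idem)
  also have "gen q \<bullet> gen p \<bullet> (eps s \<bullet> eps t) = gen q \<bullet> (gen p \<bullet> (eps s \<bullet> eps t))"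
    using assms S by (simp add: Pr.mul_assoc closed)
  also have "\<dots> = eps t \<bullet> eps s" using pst ts by simp
  finally show ?thesis .
qed

section \<open>Products of the idempotents \<open>eps s\<close>\<close>

lemma eps_idem: "s \<in> S \<Longrightarrow> eps s \<bullet> eps s = eps s"
  by (simp add: eps_def Pr.mul_assoc closed gen_relations_left)

lemma eps_of_idem: "e \<in> S \<Longrightarrow> e \<cdot> e = e \<Longrightarrow> eps e = gen e"
  by (simp add: eps_def star_idem gen_idem)

text \<open>The subsemigroup generated by the elements \<open>eps s\<close>. It starts from single
  factors because \<open>Pr\<close> need not have a unit.\<close>

inductive_set eps_products :: "'a list set set" where
  eps: "s \<in> S \<Longrightarrow> eps s \<in> eps_products"
| mul: "s \<in> S \<Longrightarrow> e \<in> eps_products \<Longrightarrow> eps s \<bullet> e \<in> eps_products"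

lemma eps_products_closed: "e \<in> eps_products \<Longrightarrow> e \<in> Pr"
  by (induction rule: eps_products.induct) (simp_all add: closed)

lemma eps_products_mul: "e \<in> eps_products \<Longrightarrow> f \<in> eps_products \<Longrightarrow> e \<bullet> f \<in> eps_products"
  by (induction rule: eps_products.induct)
    (simp_all add: eps_products.mul Pr.mul_assoc closed eps_products_closed)

lemma mul_left_commute:
  assumes "A \<in> Pr" "B \<in> Pr" "C \<in> Pr" "A \<bullet> B = B \<bullet> A"
  shows "A \<bullet> (B \<bullet> C) = B \<bullet> (A \<bullet> C)"
  using assms by (metis Pr.mul_assoc)

lemma mul_commute_product:
  assumes "A \<in> Pr" "B \<in> Pr" "C \<in> Pr" "A \<bullet> C = C \<bullet> A" "B \<bullet> C = C \<bullet> B"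
  shows "A \<bullet> B \<bullet> C = C \<bullet> (A \<bullet> B)"
  using assms by (metis Pr.mul_assoc)

lemma eps_products_commute_eps:
  assumes "e \<in> eps_products" "s \<in> S"
  shows "e \<bullet> eps s = eps s \<bullet> e"
  using assms(1)
  by (induction rule: eps_products.induct)
    (rule eps_commute mul_commute_product, (simp_all add: assms(2) eps_commute closed eps_products_closed)?)+

lemma eps_products_commute:
  assumes "e \<in> eps_products" "f \<in> eps_products"
  shows "e \<bullet> f = f \<bullet> e"
  using assms(1)
  by (induction rule: eps_products.induct)
    (simp_all add: assms(2) eps_products_commute_eps mul_commute_product closed eps_products_closed)

lemma eps_products_idem: "e \<in> eps_products \<Longrightarrow> e \<bullet> e = e"
proof (induction rule: eps_products.induct)
  case (mul s e)
  then have "e \<in> Pr" "eps s \<in> Pr" by (simp_all add: eps_products_closed closed)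
  then have "eps s \<bullet> e \<bullet> (eps s \<bullet> e) = eps s \<bullet> (eps s \<bullet> (e \<bullet> e))"
    using mul.hyps eps_products_commute_eps[of e s] mul_left_commute[of e "eps s" e]
    by (simp add: Pr.mul_assoc closed)
  also have "\<dots> = eps s \<bullet> e"
    using mul.hyps mul.IH \<open>e \<in> Pr\<close> \<open>eps s \<in> Pr\<close> by (simp add: eps_idem Pr.mul_assoc[symmetric])
  finally show ?case .
qed (simp add: eps_idem)

text \<open>Apply \<open>gen_mul_eps\<close> to one factor after another: each index
  \<open>s\<close> becomes \<open>t \<cdot> s\<close>.\<close>

lemma gen_mul_eps_products:
  assumes "e \<in> eps_products" "t \<in> S"
  shows "\<exists>f\<in>eps_products. gen t \<bullet> e = f \<bullet> gen t"
  using assms(1)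
proof (induction rule: eps_products.induct)
  case (eps s)
  then show ?case
    using gen_mul_eps[of s t] eps_products.eps[of "t \<cdot> s"] assms(2) by (auto simp: closed)
next
  case (mul s e)
  then obtain f where f: "f \<in> eps_products" "gen t \<bullet> e = f \<bullet> gen t" by blast
  have Pr: "e \<in> Pr" "f \<in> Pr" using mul.hyps f by (simp_all add: eps_products_closed)
  have "gen t \<bullet> (eps s \<bullet> e) = gen t \<bullet> eps s \<bullet> e"
    using mul.hyps Pr assms(2) by (simp add: Pr.mul_assoc closed)
  also have "\<dots> = eps (t \<cdot> s) \<bullet> f \<bullet> gen t"
    using f mul.hyps Pr assms(2) by (simp add: gen_mul_eps Pr.mul_assoc closed)
  finally show ?case
    using f mul.hyps assms(2) eps_products.mul[of "t \<cdot> s" f] by (auto simp: closed)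
qed

section \<open>Normal form, regularity and idempotents of \<open>Pr\<close>\<close>

lemma Pr_normal_form:
  assumes "A \<in> Pr"
  shows "\<exists>e\<in>eps_products. \<exists>s\<in>S. A = e \<bullet> gen s"
  using assms
proof (induction rule: Pr_induct)
  case (gen s)
  then show ?case using eps_mul_gen[of s] eps_products.eps[of s] by metis
next
  case (mul t B)
  then obtain e s where B: "e \<in> eps_products" "s \<in> S" "B = e \<bullet> gen s" by blast
  obtain f where f: "f \<in> eps_products" "gen t \<bullet> e = f \<bullet> gen t"
    using gen_mul_eps_products[OF B(1) mul.hyps(1)] by blast
  have Pr: "e \<in> Pr" "f \<in> Pr" using B f by (simp_all add: eps_products_closed)
  \<comment> \<open>After \<open>gen t\<close> has passed \<open>e\<close>,
    \<open>gen_mul_gen\<close> merges the two letters; the \<open>eps t\<close> it produces joins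
    the prefix.\<close>
  have "gen t \<bullet> B = gen t \<bullet> e \<bullet> gen s" using B Pr mul.hyps by (simp add: Pr.mul_assoc closed)
  also have "\<dots> = f \<bullet> eps t \<bullet> gen (t \<cdot> s)"
    unfolding f(2) using B Pr mul.hyps by (simp add: gen_mul_gen Pr.mul_assoc closed)
  finally show ?case
    using eps_products_mul[OF f(1) eps_products.eps[OF mul.hyps(1)]] mul_closed[OF mul.hyps(1) B(2)]
    by blast
qed

lemma Pr_regular:
  assumes "A \<in> Pr"
  shows "\<exists>B\<in>Pr. A \<bullet> B \<bullet> A = A"
proof -
  obtain e s where A: "e \<in> eps_products" "s \<in> S" "A = e \<bullet> gen s"
    using Pr_normal_form[OF assms] by blast
  have e: "e \<in> Pr" using A by (simp add: eps_products_closed)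
  have left: "e \<bullet> (e \<bullet> C) = e \<bullet> C" if "C \<in> Pr" for C
    using eps_products_idem[OF A(1)] e that by (metis Pr.mul_assoc)
  have "A \<bullet> (gen (s\<^sup>\<star>) \<bullet> e) \<bullet> A = e \<bullet> (eps s \<bullet> (e \<bullet> gen s))"
    using A e left by (simp add: eps_def Pr.mul_assoc closed)
  \<comment> \<open>Commuting \<open>eps s\<close> past \<open>e\<close> brings it next to
    \<open>gen s\<close>, which absorbs it.\<close>
  also have "\<dots> = e \<bullet> (e \<bullet> (eps s \<bullet> gen s))"
    using A e eps_products_commute_eps[of e s] mul_left_commute[of "eps s" e "gen s"]
    by (simp add: closed)
  also have "\<dots> = A" using A e left by (simp add: eps_mul_gen closed)
  finally show ?thesis using A e closed by blast
qed

lemma Pr_idem_in_eps_products: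
  assumes "A \<in> Pr" "A \<bullet> A = A"
  shows "A \<in> eps_products"
proof -
  obtain \<phi> where \<phi>: "\<And>s. s \<in> S \<Longrightarrow> \<phi> (gen s) = s" "\<And>A. A \<in> Pr \<Longrightarrow> \<phi> A \<in> S"
    "\<And>A B. A \<in> Pr \<Longrightarrow> B \<in> Pr \<Longrightarrow> \<phi> (A \<bullet> B) = \<phi> A \<cdot> \<phi> B"
    using Pr_retraction by blast
  obtain e s where A: "e \<in> eps_products" "s \<in> S" "A = e \<bullet> gen s"
    using Pr_normal_form[OF assms(1)] by blast
  \<comment> \<open>Since \<open>\<phi> (eps r) = r r\<^sup>\<star>\<close>, multiplying the letter
    by \<open>\<phi> f\<close> only inserts idempotents that \<open>gen_mul_range\<close> removes
    again. In the induction, \<open>f\<close> is commuted to the front so that \<open>eps r\<close>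
    meets the letter.\<close>
  have absorb: "f \<bullet> gen (\<phi> f \<cdot> t) = f \<bullet> gen t" if "f \<in> eps_products" "t \<in> S" for f t
    using that
  proof (induction arbitrary: t rule: eps_products.induct)
    case (eps r)
    then show ?case
      using gen_mul_range[of "r\<^sup>\<star>" t]
      by (simp add: eps_def \<phi> closed star_star mul_assoc Pr.mul_assoc)
  next
    case (mul r f)
    have f: "f \<in> Pr" "\<phi> f \<in> S" using mul.hyps by (simp_all add: eps_products_closed \<phi>)
    have "\<phi> (eps r \<bullet> f) \<cdot> t = r \<cdot> (r\<^sup>\<star> \<cdot> (\<phi> f \<cdot> t))"
      using mul f by (simp add: eps_def \<phi> closed mul_assoc)
    then have "eps r \<bullet> f \<bullet> gen (\<phi> (eps r \<bullet> f) \<cdot> t) = f \<bullet> (eps r \<bullet> gen (r \<cdot> (r\<^sup>\<star> \<cdot> (\<phi> f \<cdot> t))))"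
      using mul f eps_products_commute_eps[of f r, symmetric] by (simp add: Pr.mul_assoc closed)
    also have "\<dots> = f \<bullet> (eps r \<bullet> gen (\<phi> f \<cdot> t))"
      using gen_mul_range[of "r\<^sup>\<star>" "\<phi> f \<cdot> t"] mul f
      by (simp add: eps_def star_star Pr.mul_assoc closed)
    also have "\<dots> = eps r \<bullet> (f \<bullet> gen (\<phi> f \<cdot> t))"
      by (rule mul_left_commute) (use mul f eps_products_commute_eps in \<open>simp_all add: closed\<close>)
    also have "\<dots> = eps r \<bullet> f \<bullet> gen t" using mul f by (simp add: Pr.mul_assoc closed)
    finally show ?case .
  qed
  \<comment> \<open>The letter \<open>s\<close> need not be idempotent, but
    \<open>g = \<phi> e \<cdot> s\<close> is, and \<open>absorb\<close> allows it to replace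
    \<open>s\<close>. Then \<open>gen g = eps g\<close> is one more factor of the product.\<close>
  define g where "g = \<phi> A"
  have "g \<in> S" "g \<cdot> g = g" using \<phi>(2) \<phi>(3)[of A A] assms by (simp_all add: g_def)
  moreover have "A = e \<bullet> gen g" using absorb A by (simp add: g_def \<phi> eps_products_closed closed)
  ultimately show ?thesis using eps_of_idem eps_products_mul[OF A(1) eps_products.eps] by metis
qed

end

theorem theorem2p15:
  fixes G :: "'a set" and mul :: "'a \<Rightarrow> 'a \<Rightarrow> 'a"
  assumes "inverse_semigroup_on G mul"
  shows "inverse_semigroup_on (Pr_carrier G mul) (Pr_mul G mul)"
proof -
  interpret inverse_semigroup_on G mul by fact
  show ?thesis
    by (rule Pr.inverse_semigroup_on_if_regular)
      (simp_all add: Pr_regular Pr_idem_in_eps_products eps_products_commute)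
qed

end
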